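(* Let $n\ge 1$, let $C=(c_{ij})$ be a real $n\times n$ cost matrix with rank matrix $R=(r_{ij})$, let $\lambda=(\lambda^1,\dots,\lambda^n)$ with $\lambda^k\ge0$, and let dual multipliers $\alpha_i$ ($1\le i\le n$), $\beta_k$ ($1\le k\le n$), $\gamma_j\ge 0$ ($1\le j\le n$), $\delta\ge 0$, $\epsilon_k\ge 0$ ($2\le k\le n$) be given real numbers. For every facility $j\in\{1,\dots,n\}$, the dynamic programming algorithm described in the context solves the pricing subproblem for $j$: its final values satisfy $$g^j(i_n,n)+\delta+\gamma_j=\min_{S}\overline{c}_S^{\,j},\qquad S^j(i_n,n)\in\arg\min_S\overline{c}_S^{\,j},$$ where the minimum is over all sets $S$ (possibly empty) feasible for $j$. Moreover the pricing subproblem is thereby solved in polynomial time, with worst case complexity $O(n^3)$ (number of arithmetic operations and comparisons).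
   Context: The rank matrix $R=(r_{ij})$ has $r_{ij}=\ell$ if $c_{ij}$ is the $\ell$-th element in the list of all $n^2$ entries of $C$ sorted in non-decreasing order, ties being broken arbitrarily. A set $S$ of couples $(i,k)\in\{1,\dots,n\}^2$ ($i$ a client, $k$ a position) is feasible for $j$ if at most one couple of $S$ has a given first entry, at most one couple of $S$ has a given second entry, and $r_{ij}<r_{i'j}$ whenever $(i,k),(i',k')\in S$ with $k<k'$. Its cost is $c_S^j=\sum_{(i,k)\in S}\lambda^kc_{ij}$ and its reduced cost is $$\overline{c}_S^{\,j}=c_S^j+\gamma_j+\delta+\sum_{k=2}^n\sum_{i'=1}^n\sum_{j'=1}^n\Big(\sum_{(i,k)\in S:\,r_{i'j'}\ge r_{ij}}\epsilon_k+\sum_{(i,k-1)\in S:\,r_{i'j'}\le r_{ij}}\epsilon_k\Big)-\sum_{i:(i,\cdot)\in S}\alpha_i-\sum_{k:(\cdot,k)\in S}\beta_k,$$ where $(i,\cdot)\in S$ (resp. $(\cdot,k)\in S$) means $S$ contains a couple with first entry $i$ (resp. second entry $k$); in the two inner sums $k$, $i'$, $j'$ are fixed and $i$ varies. With the convention $\epsilon_1=\epsilon_{n+1}=0$, set $$d_{ij}^k=\lambda^kc_{ij}+\sum_{(i',j'):\,r_{i'j'}\ge r_{ij}}\epsilon_k+\sum_{(i',j'):\,r_{i'j'}\le r_{ij}}\epsilon_{k+1}-\alpha_i-\beta_k .$$ Algorithm for facility $j$. Let $i_1,\dots,i_n$ be the permutation of $1,\dots,n$ with $r_{i_1j}<r_{i_2j}<\dots<r_{i_nj}$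 (so $c_{i_1j}\le\dots\le c_{i_nj}$). - Step 0: $g^j(i_1,1)=\min\{0,d_{i_1j}^1\}$; $S^j(i_1,1)=\{(i_1,1)\}$ if $d_{i_1j}^1<0$, else $\emptyset$. - Step 1: for $k=2,\dots,n$, $g^j(i_1,k)=\min\{d_{i_1j}^k,g^j(i_1,k-1)\}$; $S^j(i_1,k)=S^j(i_1,k-1)$ if $g^j(i_1,k)=g^j(i_1,k-1)$, else $\{(i_1,k)\}$. - Step 2: for $l=2,\dots,n$, $g^j(i_l,1)=\min\{d_{i_lj}^1,g^j(i_{l-1},1)\}$; $S^j(i_l,1)=S^j(i_{l-1},1)$ if $g^j(i_l,1)=g^j(i_{l-1},1)$, else $\{(i_l,1)\}$. - Step 3: for $k,l=2,\dots,n$ (increasing), $g^j(i_l,k)=\min\{g^j(i_{l-1},k-1)+d_{i_lj}^k,\ g^j(i_{l-1},k-1),\ g^j(i_l,k-1),\ g^j(i_{l-1},k)\}$; $S^j(i_l,k)$ is $S^j(i_{l-1},k-1)$ if $g^j(i_l,k)=g^j(i_{l-1},k-1)$, else $S^j(i_l,k-1)$ if $g^j(i_l,k)=g^j(i_l,k-1)$, else $S^j(i_{l-1},k)$ if $g^j(i_l,k)=g^j(i_{l-1},k)$, else $S^j(i_{l-1},k-1)\cup\{(i_l,k)\}$. *)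

theory Defs
  imports Complex_Main "HOL-Library.Landau_Symbols" "HOL-Library.Monad_Syntax"
begin

section \<open>The pricing subproblem\<close>

text \<open>Clients, facilities and positions are the numbers from 1 to \<open>sites\<close>; values of the
  fields at other indices are irrelevant.\<close>

record pricing_data =
  sites :: nat
  cst :: "nat \<Rightarrow> nat \<Rightarrow> real"
  rnk :: "nat \<Rightarrow> nat \<Rightarrow> nat"
  lam :: "nat \<Rightarrow> real"
  \<alpha> :: "nat \<Rightarrow> real"
  \<beta> :: "nat \<Rightarrow> real"
  \<gamma> :: "nat \<Rightarrow> real"
  \<delta> :: real
  \<epsilon> :: "nat \<Rightarrow> real"

text \<open>The list \<open>ps\<close> sorts the positions of the matrix by their entries; its arbitrary order
  among equal entries is the tie-breaking rule.\<close>

definition is_rank_matrix :: "nat \<Rightarrow> (nat \<Rightarrow> nat \<Rightarrow> real) \<Rightarrow> (nat \<Rightarrow> nat \<Rightarrow> nat) \<Rightarrow> bool" where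
  "is_rank_matrix n c r \<longleftrightarrow>
     (\<exists>ps. distinct ps \<and> set ps = {1..n} \<times> {1..n} \<and> sorted (map (\<lambda>(i, j). c i j) ps) \<and>
        (\<forall>l\<in>{1..n * n}. \<forall>i j. ps ! (l - 1) = (i, j) \<longrightarrow> r i j = l))"

definition pricing_instance :: "pricing_data \<Rightarrow> bool" where
  "pricing_instance P \<longleftrightarrow>
     1 \<le> sites P \<and> is_rank_matrix (sites P) (cst P) (rnk P) \<and>
     (\<forall>k\<in>{1..sites P}. 0 \<le> lam P k) \<and> (\<forall>j\<in>{1..sites P}. 0 \<le> \<gamma> P j) \<and>
     0 \<le> \<delta> P \<and> (\<forall>k\<in>{2..sites P}. 0 \<le> \<epsilon> P k)"

definition feasible :: "pricing_data \<Rightarrow> nat \<Rightarrow> (nat \<times> nat) set \<Rightarrow> bool" where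
  "feasible P j S \<longleftrightarrow>
     S \<subseteq> {1..sites P} \<times> {1..sites P} \<and>
     (\<forall>i k k'. (i, k) \<in> S \<longrightarrow> (i, k') \<in> S \<longrightarrow> k = k') \<and>
     (\<forall>i i' k. (i, k) \<in> S \<longrightarrow> (i', k) \<in> S \<longrightarrow> i = i') \<and>
     (\<forall>i i' k k'. (i, k) \<in> S \<longrightarrow> (i', k') \<in> S \<longrightarrow> k < k' \<longrightarrow> rnk P i j < rnk P i' j)"

definition column_cost :: "pricing_data \<Rightarrow> nat \<Rightarrow> (nat \<times> nat) set \<Rightarrow> real" where
  "column_cost P j S = (\<Sum>(i, k)\<in>S. lam P k * cst P i j)"

definition reduced_cost :: "pricing_data \<Rightarrow> nat \<Rightarrow> (nat \<times> nat) set \<Rightarrow> real" where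
  "reduced_cost P j S =
     column_cost P j S + \<gamma> P j + \<delta> P
     + (\<Sum>k=2..sites P. \<Sum>i'=1..sites P. \<Sum>j'=1..sites P.
          (\<Sum>i\<in>{i. (i, k) \<in> S \<and> rnk P i' j' \<ge> rnk P i j}. \<epsilon> P k)
          + (\<Sum>i\<in>{i. (i, k - 1) \<in> S \<and> rnk P i' j' \<le> rnk P i j}. \<epsilon> P k))
     - (\<Sum>i\<in>{i. \<exists>k. (i, k) \<in> S}. \<alpha> P i) - (\<Sum>k\<in>{k. \<exists>i. (i, k) \<in> S}. \<beta> P k)"

section \<open>The dynamic program\<close>

text \<open>The dual values with the convention that they vanish at positions 1 and \<open>sites P + 1\<close>.\<close>

definition eps0 :: "pricing_data \<Rightarrow> nat \<Rightarrow> real" where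
  "eps0 P k = (if 2 \<le> k \<and> k \<le> sites P then \<epsilon> P k else 0)"

definition dcoef :: "pricing_data \<Rightarrow> nat \<Rightarrow> nat \<Rightarrow> nat \<Rightarrow> real" where
  "dcoef P j i k =
     lam P k * cst P i j
     + (\<Sum>(i', j')\<in>{(i', j') \<in> {1..sites P} \<times> {1..sites P}. rnk P i' j' \<ge> rnk P i j}. eps0 P k)
     + (\<Sum>(i', j')\<in>{(i', j') \<in> {1..sites P} \<times> {1..sites P}. rnk P i' j' \<le> rnk P i j}.
          eps0 P (k + 1))
     - \<alpha> P i - \<beta> P k"

text \<open>The client $i_l$: the ranks within column \<open>j\<close> are pairwise distinct, so this is the $l$-th
  client in strictly increasing order of rank.\<close>

definition client :: "pricing_data \<Rightarrow> nat \<Rightarrow> nat \<Rightarrow> nat" where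
  "client P j l = sort_key (\<lambda>i. rnk P i j) [1..<sites P + 1] ! (l - 1)"

text \<open>The first index of \<open>g\<close> and \<open>Ssol\<close> is $l$ rather than $i_l$. The values at
  index 0 are dummies.\<close>

fun g :: "pricing_data \<Rightarrow> nat \<Rightarrow> nat \<Rightarrow> nat \<Rightarrow> real" where
  "g P j l k =
     (if l = 0 \<or> k = 0 then 0
      else if l = 1 \<and> k = 1 then min 0 (dcoef P j (client P j 1) 1)
      else if l = 1 then min (dcoef P j (client P j 1) k) (g P j 1 (k - 1))
      else if k = 1 then min (dcoef P j (client P j l) 1) (g P j (l - 1) 1)
      else Min {g P j (l - 1) (k - 1) + dcoef P j (client P j l) k,
                g P j (l - 1) (k - 1), g P j l (k - 1), g P j (l - 1) k})"

declare g.simps [simp del]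

fun Ssol :: "pricing_data \<Rightarrow> nat \<Rightarrow> nat \<Rightarrow> nat \<Rightarrow> (nat \<times> nat) set" where
  "Ssol P j l k =
     (if l = 0 \<or> k = 0 then {}
      else if l = 1 \<and> k = 1 then
        (if dcoef P j (client P j 1) 1 < 0 then {(client P j 1, 1)} else {})
      else if l = 1 then
        (if g P j 1 k = g P j 1 (k - 1) then Ssol P j 1 (k - 1) else {(client P j 1, k)})
      else if k = 1 then
        (if g P j l 1 = g P j (l - 1) 1 then Ssol P j (l - 1) 1 else {(client P j l, 1)})
      else
        (if g P j l k = g P j (l - 1) (k - 1) then Ssol P j (l - 1) (k - 1)
         else if g P j l k = g P j l (k - 1) then Ssol P j l (k - 1)
         else if g P j l k = g P j (l - 1) k then Ssol P j (l - 1) k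
         else Ssol P j (l - 1) (k - 1) \<union> {(client P j l, k)}))"

declare Ssol.simps [simp del]

section \<open>The tabulated algorithm with its operation count\<close>

text \<open>A computation is its result together with the number of arithmetic operations and
  comparisons performed. Every such operation on the data, and also on table indices and loop
  counters, is charged one unit. Reading or writing an array cell and prepending to a list are
  not arithmetic and are free.\<close>

type_synonym 'a counted = "'a \<times> nat"

definition ret :: "'a \<Rightarrow> 'a counted" where
  "ret x = (x, 0)"

definition bind_counted :: "'a counted \<Rightarrow> ('a \<Rightarrow> 'b counted) \<Rightarrow> 'b counted" where
  "bind_counted m f = (fst (f (fst m)), snd m + snd (f (fst m)))"

adhoc_overloading Monad_Syntax.bind \<rightleftharpoons> bind_counted

definition charge :: "nat \<Rightarrow> unit counted" where
  "charge m = ((), m)"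

definition binop :: "('a \<Rightarrow> 'b \<Rightarrow> 'c) \<Rightarrow> 'a \<Rightarrow> 'b \<Rightarrow> 'c counted" where
  "binop f x y = (f x y, 1)"

text \<open>The loop charges a comparison and an increment of the counter per iteration.\<close>

fun for_each :: "nat list \<Rightarrow> (nat \<Rightarrow> 's \<Rightarrow> 's counted) \<Rightarrow> 's \<Rightarrow> 's counted" where
  "for_each [] body s = ret s"
| "for_each (x # xs) body s = do { charge 2; s' \<leftarrow> body x s; for_each xs body s' }"

text \<open>Insertion sort, which gives the same list as \<^const>\<open>sort_key\<close>.\<close>

fun insert_counted :: "('a \<Rightarrow> nat) \<Rightarrow> 'a \<Rightarrow> 'a list \<Rightarrow> 'a list counted" where
  "insert_counted f x [] = ret [x]"
| "insert_counted f x (y # ys) = do {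
     b \<leftarrow> binop (\<le>) (f x) (f y);
     if b then ret (x # y # ys)
     else do { zs \<leftarrow> insert_counted f x ys; ret (y # zs) } }"

fun sort_counted :: "('a \<Rightarrow> nat) \<Rightarrow> 'a list \<Rightarrow> 'a list counted" where
  "sort_counted f [] = ret []"
| "sort_counted f (x # xs) = do { ys \<leftarrow> sort_counted f xs; insert_counted f x ys }"

definition eps_counted :: "pricing_data \<Rightarrow> nat \<Rightarrow> real counted" where
  "eps_counted P k = do {
     a \<leftarrow> binop (\<le>) 2 k;
     b \<leftarrow> binop (\<le>) k (sites P);
     ret (if a \<and> b then \<epsilon> P k else 0) }"

text \<open>The ranks are exactly the numbers from 1 to $n^2$, so $n^2 + 1 - r_{ij}$ of them are at least
  $r_{ij}$ and $r_{ij}$ of them are at most $r_{ij}$; hence both sums in \<^const>\<open>dcoef\<close>, whose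
  summands are constant, take one multiplication each.\<close>

definition dcoef_counted :: "pricing_data \<Rightarrow> nat \<Rightarrow> nat \<Rightarrow> nat \<Rightarrow> real counted" where
  "dcoef_counted P j i k = do {
     x \<leftarrow> binop (*) (lam P k) (cst P i j);
     n2 \<leftarrow> binop (*) (sites P) (sites P);
     n3 \<leftarrow> binop (+) n2 1;
     up \<leftarrow> binop (-) n3 (rnk P i j);
     e \<leftarrow> eps_counted P k;
     y \<leftarrow> binop (*) (real up) e;
     k' \<leftarrow> binop (+) k 1;
     e' \<leftarrow> eps_counted P k';
     z \<leftarrow> binop (*) (real (rnk P i j)) e';
     s1 \<leftarrow> binop (+) x y;
     s2 \<leftarrow> binop (+) s1 z;
     s3 \<leftarrow> binop (-) s2 (\<alpha> P i);
     binop (-) s3 (\<beta> P k) }"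

text \<open>A table stores at \<open>(l, k)\<close> the value \<open>g\<close> and the solution set as a linked list. In the steps,
  \<open>cs ! l\<close> is $i_{l+1}$.\<close>

type_synonym dp_table = "nat \<times> nat \<Rightarrow> real \<times> (nat \<times> nat) list"

definition step0 :: "pricing_data \<Rightarrow> nat \<Rightarrow> nat list \<Rightarrow> dp_table \<Rightarrow> dp_table counted" where
  "step0 P j cs t = do {
     d \<leftarrow> dcoef_counted P j (cs ! 0) 1;
     v \<leftarrow> binop min 0 d;
     b \<leftarrow> binop (<) d 0;
     ret (t((1, 1) := (v, if b then [(cs ! 0, 1)] else []))) }"

definition step1 :: "pricing_data \<Rightarrow> nat \<Rightarrow> nat list \<Rightarrow> nat \<Rightarrow> dp_table \<Rightarrow> dp_table counted" where
  "step1 P j cs k t = do {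
     d \<leftarrow> dcoef_counted P j (cs ! 0) k;
     k' \<leftarrow> binop (-) k 1;
     v \<leftarrow> binop min d (fst (t (1, k')));
     b \<leftarrow> binop (=) v (fst (t (1, k')));
     ret (t((1, k) := (v, if b then snd (t (1, k')) else [(cs ! 0, k)]))) }"

definition step2 :: "pricing_data \<Rightarrow> nat \<Rightarrow> nat list \<Rightarrow> nat \<Rightarrow> dp_table \<Rightarrow> dp_table counted" where
  "step2 P j cs l t = do {
     l' \<leftarrow> binop (-) l 1;
     d \<leftarrow> dcoef_counted P j (cs ! l') 1;
     v \<leftarrow> binop min d (fst (t (l', 1)));
     b \<leftarrow> binop (=) v (fst (t (l', 1)));
     ret (t((l, 1) := (v, if b then snd (t (l', 1)) else [(cs ! l', 1)]))) }"

definition step3 ::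
  "pricing_data \<Rightarrow> nat \<Rightarrow> nat list \<Rightarrow> nat \<Rightarrow> nat \<Rightarrow> dp_table \<Rightarrow> dp_table counted" where
  "step3 P j cs l k t = do {
     l' \<leftarrow> binop (-) l 1;
     k' \<leftarrow> binop (-) k 1;
     d \<leftarrow> dcoef_counted P j (cs ! l') k;
     x \<leftarrow> binop (+) (fst (t (l', k'))) d;
     v1 \<leftarrow> binop min x (fst (t (l', k')));
     v2 \<leftarrow> binop min v1 (fst (t (l, k')));
     v \<leftarrow> binop min v2 (fst (t (l', k)));
     b1 \<leftarrow> binop (=) v (fst (t (l', k')));
     b2 \<leftarrow> binop (=) v (fst (t (l, k')));
     b3 \<leftarrow> binop (=) v (fst (t (l', k)));
     ret (t((l, k) := (v,
       if b1 then snd (t (l', k'))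
       else if b2 then snd (t (l, k'))
       else if b3 then snd (t (l', k))
       else (cs ! l', k) # snd (t (l', k'))))) }"

text \<open>The result is the optimal value and a list of the couples in the solution.\<close>

definition price :: "pricing_data \<Rightarrow> nat \<Rightarrow> (real \<times> (nat \<times> nat) list) counted" where
  "price P j = do {
     cs \<leftarrow> sort_counted (\<lambda>i. rnk P i j) [1..<sites P + 1];
     t0 \<leftarrow> step0 P j cs (\<lambda>_. (0, []));
     t1 \<leftarrow> for_each [2..<sites P + 1] (step1 P j cs) t0;
     t2 \<leftarrow> for_each [2..<sites P + 1] (step2 P j cs) t1;
     t3 \<leftarrow> for_each [2..<sites P + 1]
            (\<lambda>l. for_each [2..<sites P + 1] (\<lambda>k. step3 P j cs l k)) t2;
     v \<leftarrow> binop (+) (fst (t3 (sites P, sites P))) (\<delta> P);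
     w \<leftarrow> binop (+) v (\<gamma> P j);
     ret (w, snd (t3 (sites P, sites P))) }"

end

theory Submission
  imports Defs
begin

text \<open>The reduced cost of a feasible set is \<open>\<gamma> + \<delta>\<close> plus the sum of the coefficients \<open>d\<close> over
  its couples. Ordered by rank, a feasible set is a chain that increases strictly in both
  coordinates; so inside the rectangle of the first \<open>l\<close> clients and the first \<open>k\<close> positions it
  either contains the corner or misses the last client or the last position.\<close>

section \<open>Ranks\<close>

text \<open>The sorted enumeration \<open>ps\<close> lists every cell once, and looking up index
  \<open>l - 1\<close> inverts the rank. Since \<open>ps\<close> also orders equal entries, ranks
  are distinct even where costs coincide.\<close>

lemma rank_bij_betw:
  assumes "is_rank_matrix n c r"
  shows "bij_betw (\<lambda>(i, j). r i j) ({1..n} \<times> {1..n}) {1..n * n}"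
proof -
  obtain ps where ps: "distinct ps" "set ps = {1..n} \<times> {1..n}"
    and r: "\<And>l i j. l \<in> {1..n * n} \<Longrightarrow> ps ! (l - 1) = (i, j) \<Longrightarrow> r i j = l"
    using assms unfolding is_rank_matrix_def by blast
  have len: "length ps = n * n"
    using distinct_card[OF ps(1)] ps(2) by (simp add: card_cartesian_product)
  have pos: "\<exists>l\<in>{1..n * n}. ps ! (l - 1) = p \<and> (case p of (i, j) \<Rightarrow> r i j) = l"
    if p: "p \<in> {1..n} \<times> {1..n}" for p
  proof -
    obtain m where m: "m < n * n" "ps ! m = p"
      using p len unfolding ps(2)[symmetric] in_set_conv_nth by auto
    \<comment> \<open>Lists are indexed from 0 and ranks start at 1, hence the witness
      \<open>Suc m\<close>.\<close>
    then show ?thesis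
      using r[of "Suc m" "fst p" "snd p"] by (intro bexI[of _ "Suc m"]) (auto simp: split_def)
  qed
  show ?thesis
  proof (rule bij_betw_byWitness[where f' = "\<lambda>l. ps ! (l - 1)"])
    show "\<forall>a\<in>{1..n} \<times> {1..n}. ps ! ((case a of (i, j) \<Rightarrow> r i j) - 1) = a"
      using pos by blast
    show "\<forall>l\<in>{1..n * n}. (case ps ! (l - 1) of (i, j) \<Rightarrow> r i j) = l"
      using r by (auto split: prod.split)
    show "(\<lambda>(i, j). r i j) ` ({1..n} \<times> {1..n}) \<subseteq> {1..n * n}"
      using pos by blast
    show "(\<lambda>l. ps ! (l - 1)) ` {1..n * n} \<subseteq> {1..n} \<times> {1..n}"
    proof
      fix p assume "p \<in> (\<lambda>l. ps ! (l - 1)) ` {1..n * n}"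
      then obtain l where "1 \<le> l" "l \<le> n * n" "p = ps ! (l - 1)" by auto
      then show "p \<in> {1..n} \<times> {1..n}"
        using nth_mem[of "l - 1" ps] len ps(2) by simp
    qed
  qed
qed

text \<open>Transports counting along the rank bijection. It is used to evaluate the two constant
  sums in \<open>dcoef\<close> by one multiplication each.\<close>

lemma card_rank_filter:
  assumes "is_rank_matrix n c r"
  shows "card {p \<in> {1..n} \<times> {1..n}. Q (case p of (i, j) \<Rightarrow> r i j)} = card {q \<in> {1..n * n}. Q q}"
proof -
  note bij = rank_bij_betw[OF assms]
  let ?f = "\<lambda>(i, j). r i j" and ?A = "{p \<in> {1..n} \<times> {1..n}. Q (case p of (i, j) \<Rightarrow> r i j)}"
  have "?f ` ?A = {q \<in> ?f ` ({1..n} \<times> {1..n}). Q q}"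
    by blast
  then have "?f ` ?A = {q \<in> {1..n * n}. Q q}"
    unfolding bij_betw_imp_surj_on[OF bij] .
  moreover have "inj_on ?f ?A"
    using bij_betw_imp_inj_on[OF bij] by (rule inj_on_subset) auto
  ultimately show ?thesis
    using card_image[of ?f ?A] by simp
qed

section \<open>Additivity of the reduced cost\<close>

abbreviation weight :: "pricing_data \<Rightarrow> nat \<Rightarrow> (nat \<times> nat) set \<Rightarrow> real" where
  "weight P j S \<equiv> \<Sum>(i, k)\<in>S. dcoef P j i k"

lemma feasible_finite: "feasible P j S \<Longrightarrow> finite S"
  unfolding feasible_def by (meson finite_SigmaI finite_atLeastAtMost finite_subset)

lemma finite_feasible_sets: "finite {S. feasible P j S}"
  by (rule finite_subset[of _ "Pow ({1..sites P} \<times> {1..sites P})"]) (auto simp: feasible_def)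

lemma feasible_subset:
  assumes S: "feasible P j S" and "T \<subseteq> S"
  shows "feasible P j T"
  unfolding feasible_def
proof (intro conjI allI impI)
  note T = subsetD[OF assms(2)]
  show "T \<subseteq> {1..sites P} \<times> {1..sites P}"
    using S[unfolded feasible_def, THEN conjunct1] assms(2) by (rule order.trans[rotated])
  show "k = k'" if "(i, k) \<in> T" "(i, k') \<in> T" for i k k'
    using S[unfolded feasible_def, THEN conjunct2, THEN conjunct1] that[THEN T] by simp
  show "i = i'" if "(i, k) \<in> T" "(i', k) \<in> T" for i i' k
    using S[unfolded feasible_def, THEN conjunct2, THEN conjunct2, THEN conjunct1] that[THEN T]
    by simp
  show "rnk P i j < rnk P i' j" if "(i, k) \<in> T" "(i', k') \<in> T" "k < k'" for i i' k k'
    using S[unfolded feasible_def, THEN conjunct2, THEN conjunct2, THEN conjunct2]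
      that(1,2)[THEN T] that(3) by simp
qed

text \<open>Bridge between the iterated sums of \<open>reduced_cost\<close> and the sums over
  filtered pairs in \<open>dcoef\<close>.\<close>

lemma sum_matrix_filter:
  fixes e :: real
  shows "(\<Sum>i'=1..m. \<Sum>j'=1..n. if Q i' j' then e else 0)
    = (\<Sum>(i', j')\<in>{(i', j') \<in> {1..m::nat} \<times> {1..n::nat}. Q i' j'}. e)"
proof -
  have "(\<Sum>(i', j')\<in>{p \<in> {1..m} \<times> {1..n}. Q (fst p) (snd p)}. e)
    = (\<Sum>i'=1..m. \<Sum>j'=1..n. if Q i' j' then e else 0)"
    unfolding sum.cartesian_product split_def by (rule sum.inter_filter) simp
  moreover have "{p \<in> {1..m} \<times> {1..n}. Q (fst p) (snd p)}
    = {(i', j') \<in> {1..m} \<times> {1..n}. Q i' j'}"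
    by auto
  ultimately show ?thesis by simp
qed

text \<open>After exchanging sums, a fixed couple \<open>(i, k)\<close> contributes to the first
  inner sum only at index \<open>k\<close> and to the second only at \<open>k + 1\<close>; these
  contributions form its coefficient \<open>d\<close>. Feasibility makes both projections injective
  on \<open>S\<close>, so the sums of \<alpha> and \<beta> also become sums over couples.\<close>

lemma reduced_cost_eq:
  assumes "feasible P j S"
  shows "reduced_cost P j S = weight P j S + \<gamma> P j + \<delta> P"
proof -
  let ?n = "sites P"
  note fin = feasible_finite[OF assms]
  have S: "S \<subseteq> {1..?n} \<times> {1..?n}" and injs: "inj_on fst S" "inj_on snd S"
    using assms unfolding feasible_def inj_on_def by auto
  \<comment> \<open>Writing the sum with indicators over all of \<open>S\<close> makes its range
    independent of the outer indices, so that \<open>swap\<close> applies.\<close>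
  have line: "(\<Sum>i\<in>{i. (i, m) \<in> S \<and> Q i}. e) = (\<Sum>p\<in>S. if snd p = m \<and> Q (fst p) then e else 0)"
    for m Q and e :: real
  proof -
    have "(\<Sum>i\<in>{i. (i, m) \<in> S \<and> Q i}. e) = (\<Sum>p\<in>{p \<in> S. snd p = m \<and> Q (fst p)}. e)"
      by (rule sum.reindex_bij_witness[of _ fst "\<lambda>i. (i, m)"]) auto
    also have "\<dots> = (\<Sum>p\<in>S. if snd p = m \<and> Q (fst p) then e else 0)"
      by (rule sum.inter_filter[OF fin])
    finally show ?thesis .
  qed
  have swap: "(\<Sum>k=2..?n. \<Sum>i'=1..?n. \<Sum>j'=1..?n. \<Sum>p\<in>S. F p k i' j')
      = (\<Sum>p\<in>S. \<Sum>k=2..?n. \<Sum>i'=1..?n. \<Sum>j'=1..?n. F p k i' j')"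
    for F :: "nat \<times> nat \<Rightarrow> nat \<Rightarrow> nat \<Rightarrow> nat \<Rightarrow> real"
    by (simp only: sum.swap[where B = S])
  \<comment> \<open>Only \<open>k = m\<close> survives. If \<open>m\<close> lies outside
    \<open>2..?n\<close>, nothing survives, which is what the convention in \<open>eps0\<close>
    encodes.\<close>
  have pull: "(\<Sum>k=2..?n. \<Sum>i'=1..?n. \<Sum>j'=1..?n. if k = m \<and> Q i' j' then \<epsilon> P k else 0)
      = (\<Sum>i'=1..?n. \<Sum>j'=1..?n. if Q i' j' then eps0 P m else 0)" for m Q
  proof -
    have "(\<Sum>k=2..?n. \<Sum>i'=1..?n. \<Sum>j'=1..?n. if k = m \<and> Q i' j' then \<epsilon> P k else 0)
      = (\<Sum>k=2..?n. if k = m then \<Sum>i'=1..?n. \<Sum>j'=1..?n. if Q i' j' then \<epsilon> P k else 0 else 0)"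
      by (intro sum.cong refl) simp
    also have "\<dots> = (\<Sum>i'=1..?n. \<Sum>j'=1..?n. if Q i' j' then eps0 P m else 0)"
      by (auto simp: eps0_def cong: if_cong)
    finally show ?thesis .
  qed
  have down: "(\<Sum>k=2..?n. \<Sum>i'=1..?n. \<Sum>j'=1..?n.
        \<Sum>i\<in>{i. (i, k) \<in> S \<and> rnk P i' j' \<ge> rnk P i j}. \<epsilon> P k)
      = (\<Sum>p\<in>S. \<Sum>i'=1..?n. \<Sum>j'=1..?n. if rnk P i' j' \<ge> rnk P (fst p) j then eps0 P (snd p) else 0)"
    unfolding line swap pull[symmetric] by (intro sum.cong refl) auto
  \<comment> \<open>As \<open>k\<close> is at least 2, the condition \<open>k - 1 = snd p\<close>
    means \<open>k = snd p + 1\<close> without truncation.\<close>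
  have up: "(\<Sum>k=2..?n. \<Sum>i'=1..?n. \<Sum>j'=1..?n.
        \<Sum>i\<in>{i. (i, k - 1) \<in> S \<and> rnk P i' j' \<le> rnk P i j}. \<epsilon> P k)
      = (\<Sum>p\<in>S. \<Sum>i'=1..?n. \<Sum>j'=1..?n.
          if rnk P i' j' \<le> rnk P (fst p) j then eps0 P (snd p + 1) else 0)"
    unfolding line swap pull[symmetric] by (intro sum.cong refl) auto
  have "{i. \<exists>k. (i, k) \<in> S} = fst ` S" "{k. \<exists>i. (i, k) \<in> S} = snd ` S"
    by force+
  then have "reduced_cost P j S = (\<Sum>p\<in>S. dcoef P j (fst p) (snd p)) + \<gamma> P j + \<delta> P"
    unfolding reduced_cost_def column_cost_def sum.distrib down up dcoef_def sum_matrix_filter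
    by (simp add: sum.reindex[OF injs(1)] sum.reindex[OF injs(2)] sum.distrib sum_subtractf
        split_def o_def)
  then show ?thesis by (simp add: split_def)
qed

section \<open>Correctness of the recurrence\<close>

lemma g_zero [simp]: "g P j 0 k = 0" "g P j l 0 = 0"
  by (simp_all add: g.simps)

lemma Ssol_zero [simp]: "Ssol P j 0 k = {}" "Ssol P j l 0 = {}"
  by (simp_all add: Ssol.simps)

text \<open>Each branch is 0 or minimises over 0 or over an earlier value, so 0 propagates as an
  upper bound.\<close>

lemma g_nonpos: "g P j l k \<le> 0"
proof (induction P j l k rule: g.induct)
  case (1 P j l k)
  then show ?case
    by (subst g.simps) (auto simp: min_le_iff_disj)
qed

text \<open>The dummy zeros at index 0 let Steps 0 to 2 be read as instances of Step 3: on the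
  border the extra candidates are 0, which leaves the minimum unchanged by
  \<open>g_nonpos\<close>.\<close>

lemma g_Suc_Suc:
  "g P j (Suc l) (Suc k) = Min {g P j l k + dcoef P j (client P j (Suc l)) (Suc k),
     g P j l k, g P j (Suc l) k, g P j l (Suc k)}"
  using g_nonpos[of P j 1 k] g_nonpos[of P j l 1]
  by (subst g.simps) (auto simp: min_def)

text \<open>Value and set always follow the same branch. A singleton produced on the border counts
  as an insertion into the empty dummy set, so one case distinction covers all four steps.\<close>

lemma Ssol_Suc_Suc:
  fixes P j l k
  defines "d \<equiv> dcoef P j (client P j (Suc l)) (Suc k)"
  obtains "g P j (Suc l) (Suc k) = g P j l k" "Ssol P j (Suc l) (Suc k) = Ssol P j l k"
  | "g P j (Suc l) (Suc k) = g P j (Suc l) k" "Ssol P j (Suc l) (Suc k) = Ssol P j (Suc l) k"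
  | "g P j (Suc l) (Suc k) = g P j l (Suc k)" "Ssol P j (Suc l) (Suc k) = Ssol P j l (Suc k)"
  | "g P j (Suc l) (Suc k) = g P j l k + d"
    "Ssol P j (Suc l) (Suc k) = insert (client P j (Suc l), Suc k) (Ssol P j l k)"
proof -
  note S = Ssol.simps[of P j "Suc l" "Suc k"]
  \<comment> \<open>The minimum is one of its candidates; in the last branch of \<open>Ssol\<close>,
    where the three equality tests fail, it must be the first one.\<close>
  have g: "g P j (Suc l) (Suc k) = g P j l k + d \<or> g P j (Suc l) (Suc k) = g P j l k
      \<or> g P j (Suc l) (Suc k) = g P j (Suc l) k \<or> g P j (Suc l) (Suc k) = g P j l (Suc k)"
    unfolding g_Suc_Suc d_def by (auto simp: min_def)
  consider "l = 0" "k = 0" | "l = 0" "k > 0" | "l > 0" "k = 0" | "l > 0" "k > 0" by blast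
  then show ?thesis
  proof cases
    \<comment> \<open>When \<open>d = 0\<close> the set stays empty and the value is 0, which falls
      under the first alternative.\<close>
    case 1
    then show ?thesis
      using S that(1,4) g.simps[of P j 1 1] unfolding d_def
      by (cases "dcoef P j (client P j 1) 1 < 0") simp_all
  next
    case 2
    then show ?thesis
      using S that(2,4) g.simps[of P j 1 "Suc k"] unfolding d_def
      by (cases "g P j 1 (Suc k) = g P j 1 k") (simp_all add: min_def split: if_splits)
  next
    case 3
    then show ?thesis
      using S that(3,4) g.simps[of P j "Suc l" 1] unfolding d_def
      by (cases "g P j (Suc l) 1 = g P j l 1") (simp_all add: min_def split: if_splits)
  next
    case 4
    then show ?thesis
      using S g that by (simp split: if_splits)
  qed
qed

section \<open>Clients of a fixed facility in increasing order of rank\<close>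

locale pricing_problem =
  fixes P :: pricing_data and j :: nat
  assumes inst: "pricing_instance P" and facility: "j \<in> {1..sites P}"
begin

abbreviation n where "n \<equiv> sites P"
abbreviation sorted_clients where "sorted_clients \<equiv> sort_key (\<lambda>i. rnk P i j) [1..<n + 1]"

lemma rank_matrix: "is_rank_matrix n (cst P) (rnk P)"
  using inst by (simp add: pricing_instance_def)

lemma inj_on_column_rank: "inj_on (\<lambda>i. rnk P i j) {1..n}"
  using inj_onD[OF bij_betw_imp_inj_on[OF rank_bij_betw[OF rank_matrix]], of "(_, j)" "(_, j)"]
    facility
  by (auto intro!: inj_onI)

lemma nth_sorted_clients: "1 \<le> l \<Longrightarrow> sorted_clients ! (l - 1) = client P j l"
  by (simp add: client_def)

text \<open>The sorted order is a permutation of the clients, so the rectangle with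
  \<open>l = k = n\<close> contains every feasible set.\<close>

lemma client_image: "client P j ` {1..n} = {1..n}"
proof -
  have "client P j ` {1..n} = (\<lambda>m. sorted_clients ! m) ` {..<n}"
    unfolding client_def by (force simp: image_iff Bex_def intro: exI[of _ "Suc _"])
  also have "\<dots> = set sorted_clients"
    by (auto simp: set_conv_nth image_iff)
  finally show ?thesis by auto
qed

lemma client_in: "1 \<le> l \<Longrightarrow> l \<le> n \<Longrightarrow> client P j l \<in> {1..n}"
  using client_image by auto

text \<open>Sorting alone gives a weak order; injectivity of the ranks within column
  \<open>j\<close> makes it strict.\<close>

lemma rank_client_less:
  assumes "1 \<le> l" "l < l'" "l' \<le> n"
  shows "rnk P (client P j l) j < rnk P (client P j l') j"
proof -
  have "distinct (map (\<lambda>i. rnk P i j) sorted_clients)"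
    using inj_on_column_rank by (auto simp: distinct_map intro: inj_on_subset)
  then have "sorted_wrt (<) (map (\<lambda>i. rnk P i j) sorted_clients)"
    by (simp add: strict_sorted_iff del: distinct_map)
  from sorted_wrt_nth_less[OF this, of "l - 1" "l' - 1"] show ?thesis
    using assms by (simp add: client_def)
qed

text \<open>The new couple lies strictly beyond all of \<open>S\<close> in position and in rank, so
  it clashes with no entry and extends the chain at its end.\<close>

lemma feasible_insert:
  assumes "feasible P j S" "S \<subseteq> client P j ` {1..l} \<times> {1..k}" "Suc l \<le> n" "Suc k \<le> n"
  shows "feasible P j (insert (client P j (Suc l), Suc k) S)"
proof -
  have below: "k' < Suc k \<and> rnk P i j < rnk P (client P j (Suc l)) j" if "(i, k') \<in> S" for i k'
  proof -
    from \<open>(i, k') \<in> S\<close> assms(2) obtain m where "1 \<le> m" "m \<le> l" "i = client P j m" "k' \<le> k" by fastforce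
    then show ?thesis using rank_client_less[of m "Suc l"] assms(3) by simp
  qed
  have "client P j (Suc l) \<in> {1..n}" "Suc k \<in> {1..n}"
    using client_in[of "Suc l"] assms(3,4) by auto
  moreover have "(client P j (Suc l), m) \<notin> S" "(i, Suc k) \<notin> S" for m i
    using below by blast+
  moreover have "\<not> Suc k < m" if "(i, m) \<in> S" for i m
    using below[OF that] by simp
  ultimately show ?thesis
    using assms(1) below unfolding feasible_def by auto
qed

text \<open>Induction on \<open>l + k\<close>, which drops for all three predecessor cells.
  Containment in the rectangle is carried along because it makes the appended couple new, so that
  weights add up, and keeps the set feasible.\<close>

lemma Ssol_sound:
  assumes "l \<le> n" "k \<le> n"
  shows "feasible P j (Ssol P j l k) \<and> Ssol P j l k \<subseteq> client P j ` {1..l} \<times> {1..k}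
    \<and> weight P j (Ssol P j l k) = g P j l k"
  using assms
proof (induction "l + k" arbitrary: l k rule: less_induct)
  case less
  show ?case
  proof (cases "l = 0 \<or> k = 0")
    case True
    then show ?thesis by (auto simp: feasible_def)
  next
    case False
    then obtain l' k' where l': "l = Suc l'" and k': "k = Suc k'"
      using not0_implies_Suc by blast
    note IH = less.hyps[of l' k'] less.hyps[of l k'] less.hyps[of l' k]
    have mono: "client P j ` {1..l'} \<subseteq> client P j ` {1..l}" "{1..k'} \<subseteq> {1..k}"
      using l' k' by auto
    show ?thesis
    proof (cases rule: Ssol_Suc_Suc[of P j l' k'])
      case 4
      let ?S = "Ssol P j l' k'" and ?p = "(client P j l, k)"
      have S: "feasible P j ?S" "?S \<subseteq> client P j ` {1..l'} \<times> {1..k'}" "weight P j ?S = g P j l' k'"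
        using IH(1) l' k' less.prems by auto
      have "?p \<notin> ?S" using S(2) k' by auto
      then have "weight P j (insert ?p ?S) = g P j l' k' + dcoef P j (client P j l) k"
        using S(3) feasible_finite[OF S(1)] by simp
      moreover have "feasible P j (insert ?p ?S)"
        using feasible_insert[OF S(1,2)] less.prems l' k' by simp
      moreover have "insert ?p ?S \<subseteq> client P j ` {1..l} \<times> {1..k}"
        using S(2) mono l' k' by auto
      ultimately show ?thesis using 4 l' k' by simp
    next
      case 1
      then show ?thesis using IH(1) less.prems mono by (auto simp: l' k')
    next
      case 2
      then show ?thesis using IH(2) less.prems mono by (auto simp: l' k')
    next
      case 3
      then show ?thesis using IH(3) less.prems mono by (auto simp: l' k')
    qed
  qed
qed

text \<open>Each position of \<open>S\<close> relative to the corner matches a candidate of the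
  minimum: containing the corner gives the candidate with \<open>d\<close>, missing the last
  position gives \<open>g P j l k'\<close>, and missing the last client gives
  \<open>g P j l' k\<close>. The set is generalised in the induction since the first case removes
  the corner.\<close>

lemma g_lower_bound:
  assumes "l \<le> n" "k \<le> n" "feasible P j S" "S \<subseteq> client P j ` {1..l} \<times> {1..k}"
  shows "g P j l k \<le> weight P j S"
  using assms
proof (induction "l + k" arbitrary: l k S rule: less_induct)
  case less
  show ?case
  proof (cases "l = 0 \<or> k = 0")
    case True
    then have "S = {}" using less.prems by auto
    then show ?thesis using g_nonpos by simp
  next
    case False
    then obtain l' k' where l': "l = Suc l'" and k': "k = Suc k'"
      using not0_implies_Suc by blast
    let ?c = "client P j l"
    have image_Suc: "client P j ` {1..l} = insert ?c (client P j ` {1..l'})"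
      using l' by (simp add: atLeastAtMostSuc_conv)
    have rect_Suc: "{1..k} = insert k {1..k'}"
      using k' by (simp add: atLeastAtMostSuc_conv)
    have g_le: "g P j l k \<le> g P j l' k' + dcoef P j ?c k" "g P j l k \<le> g P j l k'"
      "g P j l k \<le> g P j l' k"
      unfolding l' k' g_Suc_Suc by (simp_all add: Min_le)
    have fin: "finite S" using feasible_finite less.prems by blast
    consider "(?c, k) \<in> S" | "\<And>i. (i, k) \<notin> S" | "\<And>m. (?c, m) \<notin> S"
    proof (cases "(?c, k) \<in> S")
      case False
      \<comment> \<open>If the last client sat at \<open>m < k\<close> and another client at
        \<open>k\<close>, feasibility would rank that client above the last one, although it is
        among the first \<open>l\<close>.\<close>
      have "\<not> ((?c, m) \<in> S \<and> (i, k) \<in> S)" for i m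
      proof
        assume in_S: "(?c, m) \<in> S \<and> (i, k) \<in> S"
        then have "m < k" using False less.prems(4) by (cases "m = k") auto
        then have lt: "rnk P ?c j < rnk P i j"
          using in_S less.prems(3) unfolding feasible_def by blast
        obtain q where q: "1 \<le> q" "q \<le> l" "i = client P j q"
          using in_S less.prems(4) by fastforce
        then show False
          using lt rank_client_less[of q l] less.prems(1) by (cases "q = l") auto
      qed
      then show ?thesis using that by blast
    qed
    then show ?thesis
    proof cases
      case 1
      let ?T = "S - {(?c, k)}"
      \<comment> \<open>The corner is the only couple in its row and its column, so the rest of
        \<open>S\<close> fits into the rectangle smaller by one in both directions.\<close>
      have unique: "m = k" if "(?c, m) \<in> S" for m
        using less.prems(3) 1 that unfolding feasible_def by blast
      have unique': "i = ?c" if "(i, k) \<in> S" for i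
        using less.prems(3) 1 that unfolding feasible_def by blast
      have "?T \<subseteq> client P j ` {1..l'} \<times> {1..k'}"
        using less.prems(4) unique unique' unfolding image_Suc rect_Suc by blast
      then have "g P j l' k' \<le> weight P j ?T"
        using less.hyps[of l' k' ?T] less.prems feasible_subset[OF less.prems(3), of ?T] l' k'
        by auto
      moreover have "weight P j S = dcoef P j ?c k + weight P j ?T"
        using sum.remove[OF fin 1, of "\<lambda>(i, k). dcoef P j i k"] by simp
      ultimately show ?thesis using g_le(1) by simp
    next
      case 2
      then have "S \<subseteq> client P j ` {1..l} \<times> {1..k'}"
        using less.prems(4) unfolding rect_Suc by blast
      then show ?thesis
        using less.hyps[of l k' S] less.prems l' k' g_le(2) by simp
    next
      case 3
      then have "S \<subseteq> client P j ` {1..l'} \<times> {1..k}"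
        using less.prems(4) unfolding image_Suc by blast
      then show ?thesis
        using less.hyps[of l' k S] less.prems l' k' g_le(3) by simp
    qed
  qed
qed

section \<open>Optimality over all feasible sets\<close>

lemma reduced_cost_Ssol: "reduced_cost P j (Ssol P j n n) = g P j n n + \<delta> P + \<gamma> P j"
  using Ssol_sound[of n n] by (simp add: reduced_cost_eq)

lemma reduced_cost_lower_bound:
  assumes "feasible P j S"
  shows "g P j n n + \<delta> P + \<gamma> P j \<le> reduced_cost P j S"
  using g_lower_bound[of n n S] assms client_image by (simp add: reduced_cost_eq feasible_def)

lemma g_eq_Min: "g P j n n + \<delta> P + \<gamma> P j = Min (reduced_cost P j ` {S. feasible P j S})"
  using Ssol_sound[of n n] reduced_cost_Ssol reduced_cost_lower_bound
  by (intro Min_eqI[symmetric]) (auto simp: finite_feasible_sets image_iff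
      intro!: exI[of _ "Ssol P j n n"])

lemma Ssol_arg_min: "is_arg_min (reduced_cost P j) (feasible P j) (Ssol P j n n)"
  using Ssol_sound[of n n] reduced_cost_Ssol reduced_cost_lower_bound
  by (auto simp: is_arg_min_linorder)

end

section \<open>Correctness and cost of the tabulation\<close>

lemma fst_bind_counted [simp]: "fst (bind_counted m f) = fst (f (fst m))"
  and snd_bind_counted [simp]: "snd (bind_counted m f) = snd m + snd (f (fst m))"
  by (simp_all add: bind_counted_def)

lemma counted_simps [simp]:
  "fst (ret x) = x" "snd (ret x) = 0" "snd (charge m) = m"
  "fst (binop f x y) = f x y" "snd (binop f x y) = 1"
  by (simp_all add: ret_def charge_def binop_def)

lemma fst_insert_counted: "fst (insert_counted f x xs) = insort_key f x xs"
  by (induction xs) auto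

lemma snd_insert_counted: "snd (insert_counted f x xs) \<le> length xs"
  by (induction xs) auto

lemma fst_sort_counted: "fst (sort_counted f xs) = sort_key f xs"
  by (induction xs) (auto simp: fst_insert_counted)

lemma snd_sort_counted: "snd (sort_counted f xs) \<le> length xs * length xs"
proof (induction xs)
  case (Cons x xs)
  then show ?case
    using snd_insert_counted[of f x "sort_key f xs"] by (simp add: fst_sort_counted)
qed simp

text \<open>One rule for result and cost. \<open>I x\<close> describes the state before the
  iteration with counter \<open>x\<close>, so the loop ends in \<open>I b\<close>; the summand 2 is
  the charge for loop control.\<close>

lemma for_each_invariant:
  assumes "a \<le> b" "I a s"
    and "\<And>x s. a \<le> x \<Longrightarrow> x < b \<Longrightarrow> I x s \<Longrightarrow> I (Suc x) (fst (body x s)) \<and> snd (body x s) \<le> c"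
  shows "I b (fst (for_each [a..<b] body s)) \<and> snd (for_each [a..<b] body s) \<le> (b - a) * (c + 2)"
  using assms
proof (induction "b - a" arbitrary: a s)
  case (Suc m)
  then have a: "[a..<b] = a # [Suc a..<b]" "b - a = Suc (b - Suc a)"
    by (simp_all add: upt_conv_Cons)
  have "I (Suc a) (fst (body a s))" and c: "snd (body a s) \<le> c"
    using Suc.prems(3)[of a s] Suc.prems(2) Suc.hyps(2) by auto
  moreover have "m = b - Suc a" "Suc a \<le> b" using Suc.hyps(2) by auto
  ultimately have "I b (fst (for_each [Suc a..<b] body (fst (body a s))))
      \<and> snd (for_each [Suc a..<b] body (fst (body a s))) \<le> (b - Suc a) * (c + 2)"
    using Suc.prems(3) by (intro Suc.hyps(1)) auto
  then show ?case using c unfolding a by simp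
qed simp

text \<open>The explicit domain \<open>D\<close> allows invariants about partially computed tables;
  the stored lists matter only through their sets.\<close>

definition filled :: "pricing_data \<Rightarrow> nat \<Rightarrow> (nat \<times> nat) set \<Rightarrow> dp_table \<Rightarrow> bool" where
  "filled P j D t \<longleftrightarrow>
     (\<forall>(l, k)\<in>D. fst (t (l, k)) = g P j l k \<and> set (snd (t (l, k))) = Ssol P j l k)"

lemma filled_cell:
  assumes "filled P j D t" "(l, k) \<in> D"
  shows "fst (t (l, k)) = g P j l k" "set (snd (t (l, k))) = Ssol P j l k"
  using assms by (auto simp: filled_def)

lemma filled_subset: "filled P j D t \<Longrightarrow> D' \<subseteq> D \<Longrightarrow> filled P j D' t"
  by (auto simp: filled_def)

lemma filled_upd:
  assumes "filled P j D t" "v = g P j l k" "set L = Ssol P j l k"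
  shows "filled P j (insert (l, k) D) (t((l, k) := (v, L)))"
  using assms by (auto simp: filled_def)

text \<open>Eleven direct operations, plus two evaluations of \<open>eps_counted\<close> at two
  comparisons each.\<close>

lemma snd_dcoef_counted: "snd (dcoef_counted P j i k) = 15"
  by (simp add: dcoef_counted_def eps_counted_def)

text \<open>On top of the 15 units for the coefficient come 2, 3, 3 and 9 operations on indices,
  minima and tests.\<close>

lemma snd_step:
  "snd (step0 P j cs t) = 17" "snd (step1 P j cs k t) = 18"
  "snd (step2 P j cs l t) = 18" "snd (step3 P j cs l k t) = 24"
  by (simp_all add: step0_def step1_def step2_def step3_def snd_dcoef_counted)

section \<open>Agreement of the tabulated steps with the recurrence\<close>

context pricing_problem
begin

lemma fst_dcoef_counted:
  assumes "i \<in> {1..n}"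
  shows "fst (dcoef_counted P j i k) = dcoef P j i k"
proof -
  let ?r = "rnk P i j"
  have r: "1 \<le> ?r" "?r \<le> n * n"
    using bij_betwE[OF rank_bij_betw[OF rank_matrix]] assms facility by force+
  \<comment> \<open>The lower bound on \<open>?r\<close> turns the first filter into an interval,
    the upper bound the second.\<close>
  have "{q \<in> {1..n * n}. ?r \<le> q} = {?r..n * n}" "{q \<in> {1..n * n}. q \<le> ?r} = {1..?r}"
    using r by auto
  then have "card {(i', j') \<in> {1..n} \<times> {1..n}. ?r \<le> rnk P i' j'} = n * n + 1 - ?r"
    "card {(i', j') \<in> {1..n} \<times> {1..n}. rnk P i' j' \<le> ?r} = ?r"
    using card_rank_filter[OF rank_matrix, of "\<lambda>q. ?r \<le> q"]
      card_rank_filter[OF rank_matrix, of "\<lambda>q. q \<le> ?r"]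
    by (simp_all add: split_def mem_Times_iff)
  then have sums:
    "(\<Sum>(i', j')\<in>{(i', j') \<in> {1..n} \<times> {1..n}. ?r \<le> rnk P i' j'}. e)
      = real (n * n + 1 - ?r) * e"
    "(\<Sum>(i', j')\<in>{(i', j') \<in> {1..n} \<times> {1..n}. rnk P i' j' \<le> ?r}. e) = real ?r * e" for e :: real
    by (simp_all only: split_def sum_constant)
  show ?thesis
    unfolding dcoef_counted_def dcoef_def sums eps_counted_def eps0_def by simp
qed

lemma fst_dcoef_client:
  assumes "1 \<le> l" "l \<le> n"
  shows "fst (dcoef_counted P j (client P j l) k) = dcoef P j (client P j l) k"
  using fst_dcoef_counted client_in assms by blast

lemma step0_correct:
  "filled P j {(1, 1)} (fst (step0 P j sorted_clients t))"
proof -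
  have "1 \<le> n" using facility by simp
  \<comment> \<open>Any table is filled on the empty domain, so the initial contents are
    irrelevant.\<close>
  then have "filled P j (insert (1, 1) {}) (fst (step0 P j sorted_clients t))"
    unfolding step0_def fst_bind_counted counted_simps
    using nth_sorted_clients[of 1] fst_dcoef_client[of 1]
    by (intro filled_upd) (simp_all add: filled_def g.simps[of _ _ "Suc 0" "Suc 0"] Ssol.simps[of _ _ "Suc 0" "Suc 0"])
  then show "filled P j {(1, 1)} (fst (step0 P j sorted_clients t))" by simp
qed

lemma step1_correct:
  assumes "filled P j D t" "(1, k - 1) \<in> D" "2 \<le> k"
  shows "filled P j (insert (1, k) D) (fst (step1 P j sorted_clients k t))"
proof -
  have "1 \<le> n" using facility by simp
  then show "filled P j (insert (1, k) D) (fst (step1 P j sorted_clients k t))"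
    unfolding step1_def fst_bind_counted counted_simps
    using nth_sorted_clients[of 1] fst_dcoef_client[of 1] filled_cell[OF assms(1,2)] assms(3)
    by (intro filled_upd[OF assms(1)]) (simp_all add: g.simps[of _ _ "Suc 0" k] Ssol.simps[of _ _ "Suc 0" k])
qed

lemma step2_correct:
  assumes "filled P j D t" "(l - 1, 1) \<in> D" "2 \<le> l" "l \<le> n"
  shows "filled P j (insert (l, 1) D) (fst (step2 P j sorted_clients l t))"
proof -
  show "filled P j (insert (l, 1) D) (fst (step2 P j sorted_clients l t))"
    unfolding step2_def fst_bind_counted counted_simps
    using nth_sorted_clients[of l] fst_dcoef_client[of l] filled_cell[OF assms(1,2)] assms(3,4)
    by (intro filled_upd[OF assms(1)]) (simp_all add: g.simps[of _ _ l "Suc 0"] Ssol.simps[of _ _ l "Suc 0"])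
qed

lemma step3_correct:
  assumes "filled P j D t" "(l - 1, k - 1) \<in> D" "(l, k - 1) \<in> D" "(l - 1, k) \<in> D"
    and "2 \<le> l" "l \<le> n" "2 \<le> k"
  shows "filled P j (insert (l, k) D) (fst (step3 P j sorted_clients l k t))"
proof -
  have d: "fst (dcoef_counted P j (sorted_clients ! (l - 1)) k) = dcoef P j (client P j l) k"
    using nth_sorted_clients[of l] fst_dcoef_client[of l] assms(5,6) by simp
  \<comment> \<open>The three binary minima computed by the step equal the fourfold
    \<open>Min\<close>; once they are folded to \<open>g\<close>, the equality tests are literally
    those of \<open>Ssol\<close>.\<close>
  have g: "min (min (min (g P j (l - 1) (k - 1) + dcoef P j (client P j l) k)
      (g P j (l - 1) (k - 1))) (g P j l (k - 1))) (g P j (l - 1) k) = g P j l k"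
    using assms(5,7) by (simp add: g.simps[of _ _ l k] min.assoc)
  show "filled P j (insert (l, k) D) (fst (step3 P j sorted_clients l k t))"
    unfolding step3_def fst_bind_counted counted_simps d
      filled_cell(1)[OF assms(1,2)] filled_cell(1)[OF assms(1,3)] filled_cell(1)[OF assms(1,4)] g
    using nth_sorted_clients[of l] assms(5,7) filled_cell(2)[OF assms(1,2)]
      filled_cell(2)[OF assms(1,3)] filled_cell(2)[OF assms(1,4)]
    by (intro filled_upd[OF assms(1)]) (simp_all add: Ssol.simps[of _ _ l k])
qed

lemma price_correct:
  "fst (fst (price P j)) = g P j n n + \<delta> P + \<gamma> P j"
  "set (snd (fst (price P j))) = Ssol P j n n"
  "snd (price P j) \<le> 100 * n ^ 3"
proof -
  let ?step3 = "\<lambda>l k. step3 P j sorted_clients l k"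
  define t0 where "t0 = fst (step0 P j sorted_clients (\<lambda>_. (0, [])))"
  define m1 where "m1 = for_each [2..<n + 1] (step1 P j sorted_clients) t0"
  define m2 where "m2 = for_each [2..<n + 1] (step2 P j sorted_clients) (fst m1)"
  define m3 where "m3 = for_each [2..<n + 1] (\<lambda>l. for_each [2..<n + 1] (?step3 l)) (fst m2)"
  have n: "1 \<le> n" using facility by simp
  have 1: "filled P j ({1} \<times> {1..<n + 1}) (fst m1) \<and> snd m1 \<le> (n + 1 - 2) * (18 + 2)"
    unfolding m1_def
  proof (rule for_each_invariant[where I = "\<lambda>k. filled P j ({1} \<times> {1..<k})"])
    show "filled P j ({1} \<times> {1..<2}) t0"
      using step0_correct unfolding t0_def by (rule filled_subset) auto
    fix k t assume k: "2 \<le> k" and t: "filled P j ({1} \<times> {1..<k}) t"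
    have "filled P j (insert (1, k) ({1} \<times> {1..<k})) (fst (step1 P j sorted_clients k t))"
      using k by (intro step1_correct[OF t]) auto
    then have "filled P j ({1} \<times> {1..<Suc k}) (fst (step1 P j sorted_clients k t))"
      by (rule filled_subset) auto
    then show "filled P j ({1} \<times> {1..<Suc k}) (fst (step1 P j sorted_clients k t))
        \<and> snd (step1 P j sorted_clients k t) \<le> 18"
      by (simp add: snd_step)
  qed (use n in simp)
  \<comment> \<open>The row of the first client is complete, and position 1 is done for all clients
    before \<open>l\<close>.\<close>
  let ?D2 = "\<lambda>l. {1} \<times> {1..<n + 1} \<union> {1..<l} \<times> {1}"
  have 2: "filled P j (?D2 (n + 1)) (fst m2) \<and> snd m2 \<le> (n + 1 - 2) * (18 + 2)"
    unfolding m2_def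
  proof (rule for_each_invariant[where I = "\<lambda>l. filled P j (?D2 l)"])
    show "filled P j (?D2 2) (fst m1)"
      using 1[THEN conjunct1] by (rule filled_subset) (use n in auto)
    fix l t assume l: "2 \<le> l" "l < n + 1" and t: "filled P j (?D2 l) t"
    have "filled P j (insert (l, 1) (?D2 l)) (fst (step2 P j sorted_clients l t))"
      using l by (intro step2_correct[OF t]) auto
    then have "filled P j (?D2 (Suc l)) (fst (step2 P j sorted_clients l t))"
      by (rule filled_subset) auto
    then show "filled P j (?D2 (Suc l)) (fst (step2 P j sorted_clients l t))
        \<and> snd (step2 P j sorted_clients l t) \<le> 18"
      by (simp add: snd_step)
  qed (use n in simp)
  \<comment> \<open>All rows before \<open>l\<close> and the column of position 1 are complete; for
    \<open>l = 2\<close> this is covered by the outcome of Step 2.\<close>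
  let ?D3 = "\<lambda>l. {1..<l} \<times> {1..<n + 1} \<union> {1..<n + 1} \<times> {1}"
  have 3: "filled P j (?D3 (n + 1)) (fst m3)
      \<and> snd m3 \<le> (n + 1 - 2) * ((n + 1 - 2) * (24 + 2) + 2)"
    unfolding m3_def
  proof (rule for_each_invariant[where I = "\<lambda>l. filled P j (?D3 l)"])
    show "filled P j (?D3 2) (fst m2)"
      using 2[THEN conjunct1] by (rule filled_subset) auto
    fix l t assume l: "2 \<le> l" "l < n + 1" and t: "filled P j (?D3 l) t"
    \<comment> \<open>The inner loop adds the current row up to \<open>k\<close>. All three
      predecessors of \<open>(l, k)\<close> are then available, and at \<open>k = n + 1\<close> row
      \<open>l\<close> is complete.\<close>
    let ?D = "\<lambda>k. ?D3 l \<union> {l} \<times> {1..<k}"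
    have inner: "filled P j (?D (n + 1)) (fst (for_each [2..<n + 1] (?step3 l) t))
        \<and> snd (for_each [2..<n + 1] (?step3 l) t) \<le> (n + 1 - 2) * (24 + 2)"
    proof (rule for_each_invariant[where I = "\<lambda>k. filled P j (?D k)"])
      show "filled P j (?D 2) t"
        using t by (rule filled_subset) (use l in auto)
      fix k t assume k: "2 \<le> k" "k < n + 1" and t: "filled P j (?D k) t"
      have mem: "(l - 1, k - 1) \<in> ?D k" "(l, k - 1) \<in> ?D k" "(l - 1, k) \<in> ?D k"
        using l k by auto
      have "filled P j (insert (l, k) (?D k)) (fst (?step3 l k t))"
        using l k by (intro step3_correct[OF t mem]) auto
      then have "filled P j (?D (Suc k)) (fst (?step3 l k t))"
        by (rule filled_subset) auto
      then show "filled P j (?D (Suc k)) (fst (?step3 l k t)) \<and> snd (?step3 l k t) \<le> 24"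
        by (simp add: snd_step)
    qed (use n in simp)
    have "filled P j (?D3 (Suc l)) (fst (for_each [2..<n + 1] (?step3 l) t))"
      using inner[THEN conjunct1] by (rule filled_subset) (auto simp: less_Suc_eq)
    with inner show "filled P j (?D3 (Suc l)) (fst (for_each [2..<n + 1] (?step3 l) t))
        \<and> snd (for_each [2..<n + 1] (?step3 l) t) \<le> (n + 1 - 2) * (24 + 2)"
      by blast
  qed (use n in simp)
  have corner: "fst (fst m3 (n, n)) = g P j n n" "set (snd (fst m3 (n, n))) = Ssol P j n n"
    using filled_cell[OF 3[THEN conjunct1], of n n] n by auto
  have fst_price: "fst (price P j) = (fst (fst m3 (n, n)) + \<delta> P + \<gamma> P j, snd (fst m3 (n, n)))"
    unfolding price_def fst_bind_counted counted_simps fst_sort_counted m3_def m2_def m1_def t0_def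
    by simp
  show "fst (fst (price P j)) = g P j n n + \<delta> P + \<gamma> P j"
    "set (snd (fst (price P j))) = Ssol P j n n"
    using fst_price corner by simp_all
  \<comment> \<open>The 17 units come from Step 0, the final 2 from adding \<delta> and
    \<gamma>.\<close>
  have "snd (price P j) = snd (sort_counted (\<lambda>i. rnk P i j) [1..<n + 1]) + 17 + snd m1 + snd m2
      + snd m3 + 2"
    unfolding price_def snd_bind_counted fst_bind_counted counted_simps fst_sort_counted
      snd_step(1) m3_def m2_def m1_def t0_def by simp
  \<comment> \<open>Each loop runs \<open>n - 1\<close> times, rounded up to \<open>n\<close>; 20
    and 26 are the step costs 18 and 24 plus loop control.\<close>
  also have "\<dots> \<le> n * n + 17 + n * 20 + n * 20 + n * (n * 26 + 2) + 2"
  proof -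
    have "snd m3 \<le> n * (n * 26 + 2)"
      by (rule order.trans[OF 3[THEN conjunct2]]) (intro mult_le_mono add_le_mono; simp)
    moreover have "snd m1 \<le> n * 20" "snd m2 \<le> n * 20"
      using 1 2 by auto
    moreover have "snd (sort_counted (\<lambda>i. rnk P i j) [1..<n + 1]) \<le> n * n"
      using snd_sort_counted[of "\<lambda>i. rnk P i j" "[1..<n + 1]"] unfolding length_upt by simp
    ultimately show ?thesis by linarith
  qed
  also have "\<dots> = 27 * n ^ 2 + 42 * n + 19"
    by (simp add: power2_eq_square algebra_simps)
  \<comment> \<open>As \<open>n\<close> is at least 1, lower powers are bounded by the cube; the
    coefficients total 88, which is below 100.\<close>
  also have "\<dots> \<le> 27 * n ^ 3 + 42 * n ^ 3 + 19 * n ^ 3"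
    using n power_increasing[of 2 3 n] power_increasing[of 1 3 n] power_increasing[of 0 3 n]
    by (intro add_mono mult_le_mono) simp_all
  finally show "snd (price P j) \<le> 100 * n ^ 3" by simp
qed

end

theorem mainTheorem4:
  shows "(\<forall>(P :: pricing_data) j. pricing_instance P \<longrightarrow> j \<in> {1..sites P} \<longrightarrow>
            g P j (sites P) (sites P) + \<delta> P + \<gamma> P j
              = Min (reduced_cost P j ` {S. feasible P j S}) \<and>
            is_arg_min (reduced_cost P j) (feasible P j) (Ssol P j (sites P) (sites P)))
       \<and> (\<exists>T :: nat \<Rightarrow> real. T \<in> O(\<lambda>n. real n ^ 3) \<and>
            (\<forall>(P :: pricing_data) j. pricing_instance P \<longrightarrow> j \<in> {1..sites P} \<longrightarrow>
               (\<exists>v L steps. price P j = ((v, L), steps) \<and>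
                  v = g P j (sites P) (sites P) + \<delta> P + \<gamma> P j \<and>
                  set L = Ssol P j (sites P) (sites P) \<and>
                  real steps \<le> T (sites P))))"
proof (intro conjI)
  show "\<forall>(P :: pricing_data) j. pricing_instance P \<longrightarrow> j \<in> {1..sites P} \<longrightarrow>
      g P j (sites P) (sites P) + \<delta> P + \<gamma> P j = Min (reduced_cost P j ` {S. feasible P j S}) \<and>
      is_arg_min (reduced_cost P j) (feasible P j) (Ssol P j (sites P) (sites P))"
    using pricing_problem.g_eq_Min pricing_problem.Ssol_arg_min pricing_problem.intro by blast
  \<comment> \<open>The bound depends on the instance only through \<open>sites P\<close>, so one
    function serves as \<open>T\<close> for all instances and facilities.\<close>
  have "\<exists>v L steps. price P j = ((v, L), steps) \<and>
      v = g P j (sites P) (sites P) + \<delta> P + \<gamma> P j \<and>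
      set L = Ssol P j (sites P) (sites P) \<and> real steps \<le> 100 * real (sites P) ^ 3"
    if "pricing_instance P" "j \<in> {1..sites P}" for P :: pricing_data and j
  proof -
    interpret pricing_problem P j using that by unfold_locales
    obtain v L steps where price: "price P j = ((v, L), steps)" by (metis prod.exhaust)
    then have "real steps \<le> real (100 * sites P ^ 3)"
      using price_correct(3) by (simp only: of_nat_le_iff snd_conv)
    then show ?thesis using price price_correct(1,2) by simp
  qed
  moreover have "(\<lambda>n. 100 * real n ^ 3) \<in> O(\<lambda>n. real n ^ 3)" by simp
  ultimately show "\<exists>T :: nat \<Rightarrow> real. T \<in> O(\<lambda>n. real n ^ 3) \<and>
      (\<forall>(P :: pricing_data) j. pricing_instance P \<longrightarrow> j \<in> {1..sites P} \<longrightarrow>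
         (\<exists>v L steps. price P j = ((v, L), steps) \<and>
            v = g P j (sites P) (sites P) + \<delta> P + \<gamma> P j \<and>
            set L = Ssol P j (sites P) (sites P) \<and> real steps \<le> T (sites P)))"
    by (intro exI[of _ "\<lambda>n. 100 * real n ^ 3"]) blast
qed

end
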